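(* In the $(n,\iota)$ game on $\mathbb{Z}^2$, neither player can force a win in time less than $(1-o(1))n$ as $n \to \infty$. That is, for every $\varepsilon > 0$ there exists $N$ such that for every integer $n \geq N$ and each of the two players $P$ (first or second), the opponent of $P$ has a strategy which guarantees that $P$ does not win at any time $t < (1-\varepsilon)n$.
   Context: The $(n,\iota)$ game, for a positive integer $n$, is played by two players on the board $\mathbb{Z}^2$. The winning sets are all sets of $n$ consecutive points in a line, horizontally, vertically or diagonally, i.e. all sets $\{v + i d : 0 \leq i \leq n-1\}$ with $v \in \mathbb{Z}^2$ and $d \in \{(1,0),(0,1),(1,1),(1,-1)\}$. Turns are numbered (timed) $t = 1, 2, 3, \ldots$. The first player moves at odd times and the second player at even times, and at time $t$ the player to move claims exactly $t$ points of the board, none of which has previously been claimed by either player. Both players have complete information about all previous moves. The first player to claim all points of some winning set wins (and the game ends); a player wins at time $t$ if he first completes a winning set with the points claimed at time $t$ and the opponent has not completed one earlier. *)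

theory Defs
  imports Complex_Main
begin

type_synonym point = "int \<times> int"

text \<open>Element \<open>i\<close> of a history is the set of points claimed at time \<open>i + 1\<close>.\<close>

type_synonym history = "point set list"

datatype player = First | Second

fun opponent :: "player \<Rightarrow> player" where
  "opponent First = Second"
| "opponent Second = First"

definition directions :: "(int \<times> int) set" where
  "directions = {(1, 0), (0, 1), (1, 1), (1, -1)}"

definition line_points :: "nat \<Rightarrow> point \<Rightarrow> int \<times> int \<Rightarrow> point set" where
  "line_points n v d = {(fst v + int i * fst d, snd v + int i * snd d) | i. i < n}"

definition winning_sets :: "nat \<Rightarrow> point set set" where
  "winning_sets n = {line_points n v d | v d. d \<in> directions}"

definition mover :: "nat \<Rightarrow> player" where
  "mover t = (if odd t then First else Second)"

definition claimed :: "player \<Rightarrow> history \<Rightarrow> point set" where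
  "claimed P h = \<Union> {h ! i | i. i < length h \<and> mover (i + 1) = P}"

definition completed :: "nat \<Rightarrow> player \<Rightarrow> history \<Rightarrow> bool" where
  "completed n P h \<longleftrightarrow> (\<exists>W \<in> winning_sets n. W \<subseteq> claimed P h)"

definition game_over :: "nat \<Rightarrow> history \<Rightarrow> bool" where
  "game_over n h \<longleftrightarrow> (\<exists>P. completed n P h)"

definition legal_move :: "history \<Rightarrow> point set \<Rightarrow> bool" where
  "legal_move h M \<longleftrightarrow> finite M \<and> card M = length h + 1 \<and> M \<inter> \<Union> (set h) = {}"

inductive legal_history :: "nat \<Rightarrow> history \<Rightarrow> bool" for n where
  start: "legal_history n []"
| move: "legal_history n h \<Longrightarrow> \<not> game_over n h \<Longrightarrow> legal_move h M \<Longrightarrow> legal_history n (h @ [M])"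

definition wins_at :: "nat \<Rightarrow> player \<Rightarrow> history \<Rightarrow> nat \<Rightarrow> bool" where
  "wins_at n P h t \<longleftrightarrow> 1 \<le> t \<and> t \<le> length h \<and> mover t = P \<and>
     completed n P (take t h) \<and> \<not> completed n P (take (t - 1) h) \<and>
     \<not> completed n (opponent P) (take (t - 1) h)"

definition is_strategy :: "nat \<Rightarrow> player \<Rightarrow> (history \<Rightarrow> point set) \<Rightarrow> bool" where
  "is_strategy n P \<sigma> \<longleftrightarrow>
     (\<forall>h. legal_history n h \<longrightarrow> \<not> game_over n h \<longrightarrow> mover (length h + 1) = P \<longrightarrow> legal_move h (\<sigma> h))"

definition follows :: "player \<Rightarrow> (history \<Rightarrow> point set) \<Rightarrow> history \<Rightarrow> bool" where
  "follows P \<sigma> h \<longleftrightarrow> (\<forall>i < length h. mover (i + 1) = P \<longrightarrow> h ! i = \<sigma> (take i h))"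

end

theory Submission
  imports Defs "HOL-Real_Asymp.Real_Asymp"
begin

text \<open>
  Call the player \<open>P\<close> Maker and his opponent Breaker. Fix a large constant \<open>m\<close> and consider only the
  segments (\<^emph>\<open>boxes\<close>) of length \<open>n - n div m\<close> whose starting coordinate is a multiple of \<open>n div m\<close>.
  Every winning set contains a box, while every point lies in at most \<open>8 * m\<close> boxes. Breaker always
  hits the boxes that contain most Maker points among those he has not hit yet, one box for each
  point he may claim. As in the classical box game, an averaging argument shows that after each
  Breaker move the unhit boxes contain only \<open>O(ln n)\<close> Maker points, so Maker cannot
  fill a box before time \<open>n - n div m - O(ln n)\<close>.
\<close>

section \<open>Histories\<close>

lemma opponent_neq [simp]: "opponent P \<noteq> P" "P \<noteq> opponent P"
  by (cases P; simp)+

lemma eq_opponent_iff: "Q = opponent P \<longleftrightarrow> Q \<noteq> P"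
  by (cases P; cases Q) auto

lemma mover_Suc: "mover (Suc t) = opponent (mover t)"
  by (simp add: mover_def)

lemma claimed_Nil [simp]: "claimed P [] = {}"
  by (simp add: claimed_def)

lemma claimed_snoc:
  "claimed P (h @ [M]) = claimed P h \<union> (if mover (Suc (length h)) = P then M else {})"
  by (auto simp: claimed_def less_Suc_eq nth_append split: if_splits)

lemma Union_set_eq_claimed: "\<Union> (set h) = claimed P h \<union> claimed (opponent P) h"
  by (induction h rule: rev_induct) (auto simp: claimed_snoc eq_opponent_iff)

lemma legal_history_snoc_iff:
  "legal_history n (h @ [M]) \<longleftrightarrow> legal_history n h \<and> \<not> game_over n h \<and> legal_move h M"
  by (subst legal_history.simps) auto

lemma legal_history_take: "legal_history n h \<Longrightarrow> legal_history n (take t h)"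
proof (induction h rule: rev_induct)
  case (snoc M h)
  then show ?case
    by (cases "t \<le> length h") (auto simp: legal_history_snoc_iff)
qed simp

lemma follows_take: "follows P \<sigma> h \<Longrightarrow> follows P \<sigma> (take t h)"
  by (auto simp: follows_def min_def)

lemma follows_snoc_iff:
  "follows P \<sigma> (h @ [M]) \<longleftrightarrow> follows P \<sigma> h \<and> (mover (Suc (length h)) = P \<longrightarrow> M = \<sigma> h)"
  by (auto simp: follows_def less_Suc_eq nth_append)

lemma legal_history_finite: "legal_history n h \<Longrightarrow> finite (\<Union> (set h))"
  by (induction rule: legal_history.induct) (auto simp: legal_move_def)

lemma finite_claimed: "legal_history n h \<Longrightarrow> finite (claimed P h)"
  using legal_history_finite[of n h] by (simp add: Union_set_eq_claimed[of h P])

lemma claimed_disjoint: "legal_history n h \<Longrightarrow> claimed P h \<inter> claimed (opponent P) h = {}"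
proof (induction rule: legal_history.induct)
  case (move h M)
  then have "M \<inter> (claimed P h \<union> claimed (opponent P) h) = {}"
    by (simp add: legal_move_def Union_set_eq_claimed[of h P])
  with move.IH show ?case
    by (auto simp: claimed_snoc)
qed simp

text \<open>The board is infinite, so a small enough set of free points can be padded to a move of
  the prescribed size. Breaker therefore only has to choose the points that hit boxes.\<close>

lemma legal_move_superset:
  assumes "legal_history n h" "finite M" "card M \<le> length h + 1" "M \<inter> \<Union> (set h) = {}"
  obtains M' where "M \<subseteq> M'" "legal_move h M'"
proof -
  have "finite (M \<union> \<Union> (set h))"
    using assms legal_history_finite by blast
  then have "infinite (UNIV - (M \<union> \<Union> (set h)))"
    by (simp add: Diff_infinite_finite finite_prod)
  then obtain N where N: "N \<subseteq> UNIV - (M \<union> \<Union> (set h))" "finite N" "card N = length h + 1 - card M"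
    by (meson infinite_arbitrarily_large)
  have "card (M \<union> N) = card M + card N"
    using N assms(2) by (intro card_Un_disjoint) auto
  then have "legal_move h (M \<union> N)"
    using N assms by (auto simp: legal_move_def)
  then show thesis
    using that by blast
qed

section \<open>The box game\<close>

text \<open>Greedy choice: keep adding a maximiser of \<open>f\<close> on the rest of
  \<open>U\<close>. It exists because \<open>f\<close> is bounded, and the infinite \<open>U\<close>
  is never exhausted.\<close>

lemma exists_top_subset:
  fixes f :: "'a \<Rightarrow> nat"
  assumes "infinite U" "\<And>x. x \<in> U \<Longrightarrow> f x \<le> b"
  shows "\<exists>T \<subseteq> U. finite T \<and> card T = m \<and> (\<forall>x \<in> T. \<forall>y \<in> U - T. f y \<le> f x)"
proof (induction m)
  case 0
  show ?case
    by (rule exI[of _ "{}"]) auto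
next
  case (Suc m)
  then obtain T where T: "T \<subseteq> U" "finite T" "card T = m" "\<forall>x \<in> T. \<forall>y \<in> U - T. f y \<le> f x"
    by auto
  have "U - T \<noteq> {}"
    using assms(1) T(2) by (metis Diff_infinite_finite infinite_imp_nonempty)
  then obtain z0 where "z0 \<in> U - T"
    by blast
  moreover have "\<forall>y. y \<in> U - T \<longrightarrow> f y < Suc b"
    using assms(2) by (simp add: less_Suc_eq_le)
  ultimately have "\<exists>z. z \<in> U - T \<and> (\<forall>y. y \<in> U - T \<longrightarrow> f y \<le> f z)"
    by (rule ex_has_greatest_nat)
  then obtain z where z: "z \<in> U - T" "\<And>y. y \<in> U - T \<Longrightarrow> f y \<le> f z"
    by metis
  show ?case
    using T z by (intro exI[of _ "insert z T"]) auto
qed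

text \<open>Double counting of incidences. It limits what a Maker move \<open>M\<close> adds to the
  total height of \<open>S\<close>.\<close>

lemma sum_card_Int_le:
  assumes "finite S" "finite M" "\<And>x. x \<in> M \<Longrightarrow> card {B \<in> S. x \<in> B} \<le> C"
  shows "(\<Sum>B\<in>S. card (B \<inter> M)) \<le> C * card M"
proof -
  have "(\<Sum>B\<in>S. card (B \<inter> M)) = (\<Sum>B\<in>S. \<Sum>x\<in>M. if x \<in> B then 1 else 0)"
    using assms(2) by (intro sum.cong refl) (simp add: sum.If_cases Int_commute)
  also have "\<dots> = (\<Sum>x\<in>M. \<Sum>B\<in>S. if x \<in> B then 1 else 0)"
    by (rule sum.swap)
  also have "\<dots> = (\<Sum>x\<in>M. card {B \<in> S. x \<in> B})"
    using assms(1) by (intro sum.cong refl) (simp add: sum.If_cases Int_def)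
  also have "\<dots> \<le> (\<Sum>x\<in>M. C)"
    using assms(3) by (rule sum_mono)
  finally show ?thesis
    by (simp add: mult.commute)
qed

text \<open>Discarding the largest values cannot raise the average; the inequality is
  cross-multiplied to avoid division. Comparing all pairs from \<open>T\<close> and \<open>S\<close>
  gives \<open>card T * sum f S \<le> card S * sum f T\<close>.\<close>

lemma sum_le_top_average:
  fixes f :: "'a \<Rightarrow> nat"
  assumes "finite S" "finite T" "S \<inter> T = {}" "\<And>x y. x \<in> T \<Longrightarrow> y \<in> S \<Longrightarrow> f y \<le> f x"
  shows "(card S + card T) * sum f S \<le> card S * sum f (S \<union> T)"
proof -
  have "card T * sum f S = (\<Sum>x\<in>T. \<Sum>y\<in>S. f y)"
    by simp
  also have "\<dots> \<le> (\<Sum>x\<in>T. \<Sum>y\<in>S. f x)"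
    using assms(4) by (intro sum_mono)
  also have "\<dots> = card S * sum f T"
    by (simp add: sum_distrib_left)
  finally show ?thesis
    using assms by (simp add: sum.union_disjoint algebra_simps)
qed

text \<open>With \<open>K = k + s + 1\<close>, the term s/K is at most (s + 1)/K = 1 - k/K \<le> ln
  (K/k). So the left side is at most ln ((K + s^2)/k), and K + s^2 falls short of k + (s + 1)^2 by
  exactly s.\<close>

lemma ln_ratio_step:
  fixes k s :: real
  assumes "k > 0" "s \<ge> 0"
  shows "ln ((k + s + 1 + s\<^sup>2) / (k + s + 1)) + s / (k + s + 1) \<le> ln ((k + (s + 1)\<^sup>2) / k)"
proof -
  define K where "K = k + s + 1"
  have pos: "K > 0" "K + s\<^sup>2 > 0"
    using assms by (auto simp: K_def add_pos_nonneg)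
  have "s / K \<le> 1 - k / K"
    using pos by (simp add: K_def field_simps)
  also have "\<dots> \<le> - ln (k / K)"
    using ln_le_minus_one[of "k / K"] pos assms by simp
  finally have "ln ((K + s\<^sup>2) / K) + s / K \<le> ln (K + s\<^sup>2) - ln k"
    using pos assms by (simp add: ln_div)
  also have "\<dots> \<le> ln (k + (s + 1)\<^sup>2) - ln k"
    using pos assms by (simp add: K_def power2_eq_square algebra_simps)
  also have "\<dots> = ln ((k + (s + 1)\<^sup>2) / k)"
    using assms by (subst ln_divide_pos) (auto intro: add_pos_nonneg)
  finally show ?thesis
    by (simp add: K_def)
qed

section \<open>Breaker's strategy for an abstract family of boxes\<close>

locale box_family =
  fixes boxes :: "point set set" and C L :: nat
  assumes infinite_boxes: "infinite boxes"
    and card_box_ge: "B \<in> boxes \<Longrightarrow> L \<le> card B"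
    and finite_degree: "finite {B \<in> boxes. x \<in> B}"
    and degree_le: "card {B \<in> boxes. x \<in> B} \<le> C"
begin

text \<open>Throughout, \<open>P\<close> is Maker and \<open>opponent P\<close> is Breaker: these
  are the boxes Maker can still hope to fill.\<close>

definition open_boxes :: "player \<Rightarrow> history \<Rightarrow> point set set" where
  "open_boxes P h = {B \<in> boxes. B \<inter> claimed (opponent P) h = {}}"

definition height :: "player \<Rightarrow> history \<Rightarrow> point set \<Rightarrow> nat" where
  "height P h B = card (B \<inter> claimed P h)"

text \<open>The height comparison ranges only over boxes missed by \<open>M\<close>, since
  \<open>M\<close> may also hit boxes outside \<open>T\<close>, and those cease to be open.\<close>

definition hits_top :: "player \<Rightarrow> history \<Rightarrow> point set \<Rightarrow> bool" where
  "hits_top P h M \<longleftrightarrow> (\<exists>T \<subseteq> open_boxes P h. finite T \<and> card T = length h + 1 \<and>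
     (\<forall>B \<in> T. B \<inter> M \<noteq> {}) \<and>
     (\<forall>A \<in> T. \<forall>B \<in> open_boxes P h. B \<inter> M = {} \<longrightarrow> height P h B \<le> height P h A))"

text \<open>The implication makes the choice a legal move even in positions without a top-hitting
  move, as \<open>is_strategy\<close> asks for legality in every position, reached or not.\<close>

definition top_strategy :: "player \<Rightarrow> history \<Rightarrow> point set" where
  "top_strategy P h = (SOME M. legal_move h M \<and>
     ((\<exists>M'. legal_move h M' \<and> hits_top P h M') \<longrightarrow> hits_top P h M))"

lemma top_strategy:
  assumes "legal_history n h"
  shows "legal_move h (top_strategy P h)"
    and "legal_move h M \<Longrightarrow> hits_top P h M \<Longrightarrow> hits_top P h (top_strategy P h)"
proof -
  obtain M where "legal_move h M"
    by (rule legal_move_superset[OF assms, of "{}"]) auto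
  then have "\<exists>M. legal_move h M \<and> ((\<exists>M'. legal_move h M' \<and> hits_top P h M') \<longrightarrow> hits_top P h M)"
    by blast
  from someI_ex[OF this, folded top_strategy_def]
  show "legal_move h (top_strategy P h)"
    and "legal_move h M \<Longrightarrow> hits_top P h M \<Longrightarrow> hits_top P h (top_strategy P h)" for M
    by blast+
qed

text \<open>Breaker owns finitely many points, each in finitely many boxes. Hence there are always
  enough open boxes to choose the top ones from.\<close>

lemma infinite_open_boxes:
  assumes "legal_history n h"
  shows "infinite (open_boxes P h)"
proof -
  have "boxes - open_boxes P h \<subseteq> (\<Union>x \<in> claimed (opponent P) h. {B \<in> boxes. x \<in> B})"
    by (auto simp: open_boxes_def)
  moreover have "finite \<dots>"
    using finite_claimed[OF assms] finite_degree by blast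
  ultimately have "finite (boxes - open_boxes P h)"
    by (rule finite_subset)
  then show ?thesis
    using infinite_boxes by (metis Diff_infinite_finite)
qed

text \<open>An open box that Maker has not filled has a free point. One such point is taken from
  each top box; the points may coincide, so the set is then padded to a full move.\<close>

lemma exists_hits_top:
  assumes h: "legal_history n h" and nofull: "\<And>B. B \<in> boxes \<Longrightarrow> \<not> B \<subseteq> claimed P h"
  shows "\<exists>M. legal_move h M \<and> hits_top P h M"
proof -
  have "height P h B \<le> card (claimed P h)" for B
    unfolding height_def using finite_claimed[OF h] by (intro card_mono) auto
  with exists_top_subset[OF infinite_open_boxes[OF h], where m = "length h + 1"]
  obtain T where T: "T \<subseteq> open_boxes P h" "finite T" "card T = length h + 1"
    "\<forall>A \<in> T. \<forall>B \<in> open_boxes P h - T. height P h B \<le> height P h A"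
    by metis
  have "\<exists>x. x \<in> B - \<Union> (set h)" if "B \<in> T" for B
  proof -
    have "B \<in> boxes" "B \<inter> claimed (opponent P) h = {}"
      using T(1) that by (auto simp: open_boxes_def)
    with nofull[of B] show ?thesis
      unfolding Union_set_eq_claimed[of h P] by blast
  qed
  then obtain p where p: "\<And>B. B \<in> T \<Longrightarrow> p B \<in> B - \<Union> (set h)"
    by metis
  obtain M where M: "p ` T \<subseteq> M" "legal_move h M"
  proof (rule legal_move_superset[OF h, of "p ` T"])
    show "card (p ` T) \<le> length h + 1"
      using T card_image_le by metis
  qed (use T p in auto)
  have "B \<inter> M \<noteq> {}" if "B \<in> T" for B
    using p[OF that] M(1) that by blast
  then have "hits_top P h M"
    unfolding hits_top_def using T by (intro exI[of _ T]) blast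
  with M show ?thesis
    by blast
qed

text \<open>The logarithm is the solution of the recursion for the largest possible average height of \<open>k\<close>
  open boxes: \<open>k\<close> boxes that survive a Breaker move at time \<open>s + 1\<close> were part of \<open>k + s + 1\<close>
  boxes of at least the same average height.\<close>

definition heights_bounded :: "player \<Rightarrow> history \<Rightarrow> bool" where
  "heights_bounded P h \<longleftrightarrow> (\<forall>S \<subseteq> open_boxes P h. finite S \<longrightarrow> S \<noteq> {} \<longrightarrow>
     real (sum (height P h) S) \<le> C * card S * ln ((card S + (length h)\<^sup>2) / card S) +
       (if mover (Suc (length h)) = P then 0 else C * length h))"

section \<open>The height bound along a play\<close>

lemma heights_bounded_Nil: "heights_bounded P []"
  by (simp add: heights_bounded_def height_def)

text \<open>Maker's move leaves the open boxes unchanged and adds at most \<open>C\<close> per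
  claimed point to the total height. This is the additive term in \<open>heights_bounded\<close>;
  the logarithm only grows with time.\<close>

lemma heights_bounded_maker:
  assumes "heights_bounded P h" "mover (Suc (length h)) = P" "legal_history n (h @ [M])"
  shows "heights_bounded P (h @ [M])"
  unfolding heights_bounded_def
proof (intro allI impI)
  fix S assume S: "S \<subseteq> open_boxes P (h @ [M])" "finite S" "S \<noteq> {}"
  define k where "k = card S"
  define s where "s = length h"
  have k: "k > 0"
    using S by (simp add: k_def card_gt_0_iff)
  have M: "finite M" "card M = Suc s"
    using assms(3) by (auto simp: legal_history_snoc_iff legal_move_def s_def)
  have op: "open_boxes P (h @ [M]) = open_boxes P h"
    using assms(2) by (simp add: open_boxes_def claimed_snoc)
  have "card {B \<in> S. x \<in> B} \<le> C" for x
  proof -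
    have "{B \<in> S. x \<in> B} \<subseteq> {B \<in> boxes. x \<in> B}"
      using S(1) unfolding open_boxes_def by blast
    from card_mono[OF finite_degree this] degree_le[of x] show ?thesis
      by linarith
  qed
  then have "(\<Sum>B\<in>S. card (B \<inter> M)) \<le> C * card M"
    using S M by (intro sum_card_Int_le) auto
  moreover have "height P (h @ [M]) B \<le> height P h B + card (B \<inter> M)" for B
    using assms(2) card_Un_le[of "B \<inter> claimed P h" "B \<inter> M"]
    by (simp add: height_def claimed_snoc Int_Un_distrib)
  then have "sum (height P (h @ [M])) S \<le> sum (height P h) S + (\<Sum>B\<in>S. card (B \<inter> M))"
    by (subst sum.distrib[symmetric]) (rule sum_mono)
  ultimately have "sum (height P (h @ [M])) S \<le> sum (height P h) S + C * Suc s"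
    using M by simp
  then have "real (sum (height P (h @ [M])) S) \<le> real (sum (height P h) S) + real (C * Suc s)"
    by (metis of_nat_add of_nat_le_iff)
  also have "real (sum (height P h) S) \<le> C * k * ln ((k + s\<^sup>2) / k)"
    using assms(1,2) S op by (simp add: heights_bounded_def k_def s_def)
  also have "\<dots> \<le> C * k * ln ((k + (Suc s)\<^sup>2) / k)"
    using k by (intro mult_left_mono ln_mono divide_right_mono)
      (auto simp: power_mono simp flip: of_nat_power of_nat_add)
  finally show "real (sum (height P (h @ [M])) S)
      \<le> C * card S * ln ((card S + (length (h @ [M]))\<^sup>2) / card S) +
        (if mover (Suc (length (h @ [M]))) = P then 0 else C * length (h @ [M]))"
    using assms(2) by (simp add: k_def s_def mover_Suc)
qed

text \<open>Before the move, the survivors \<open>S\<close> and the hit top boxes \<open>T\<close>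
  together were \<open>card S + length h + 1\<close> open boxes. Their average height bounds that of
  \<open>S\<close>, and \<open>ln_ratio_step\<close> absorbs the additive term left by
  Maker.\<close>

lemma heights_bounded_breaker:
  assumes "heights_bounded P h" "mover (Suc (length h)) = opponent P" "hits_top P h M"
  shows "heights_bounded P (h @ [M])"
  unfolding heights_bounded_def
proof (intro allI impI)
  fix S assume S: "S \<subseteq> open_boxes P (h @ [M])" "finite S" "S \<noteq> {}"
  define k where "k = card S"
  define s where "s = length h"
  have k: "k > 0"
    using S by (simp add: k_def card_gt_0_iff)
  have S': "S \<subseteq> open_boxes P h" "\<And>B. B \<in> S \<Longrightarrow> B \<inter> M = {}"
    using S(1) assms(2) by (auto simp: open_boxes_def claimed_snoc)
  obtain T where T: "T \<subseteq> open_boxes P h" "finite T" "card T = Suc s" "\<And>B. B \<in> T \<Longrightarrow> B \<inter> M \<noteq> {}"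
    "\<And>A B. A \<in> T \<Longrightarrow> B \<in> open_boxes P h \<Longrightarrow> B \<inter> M = {} \<Longrightarrow> height P h B \<le> height P h A"
    using assms(3) unfolding hits_top_def s_def by (metis Suc_eq_plus1)
  have disj: "S \<inter> T = {}"
    using S'(2) T(4) by (meson disjoint_iff)
  define K where "K = real k + real s + 1"
  have K_pos: "K > 0"
    unfolding K_def by linarith
  have card_ST: "real (card (S \<union> T)) = K"
    using disj S T by (simp add: card_Un_disjoint K_def k_def)
  have "height P (h @ [M]) = height P h"
    using assms(2) by (simp add: height_def claimed_snoc fun_eq_iff)
  then have "real (sum (height P (h @ [M])) S) = real (sum (height P h) S)"
    by simp
  moreover have "(k + Suc s) * sum (height P h) S \<le> k * sum (height P h) (S \<union> T)"
    unfolding k_def T(3)[symmetric] using S(2) T(2) disj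
  proof (rule sum_le_top_average)
    show "height P h B \<le> height P h A" if "A \<in> T" "B \<in> S" for A B
      using T(5) S' that by (meson subsetD)
  qed
  then have "real ((k + Suc s) * sum (height P h) S) \<le> real (k * sum (height P h) (S \<union> T))"
    by (rule of_nat_mono)
  then have "K * real (sum (height P h) S) \<le> k * real (sum (height P h) (S \<union> T))"
    unfolding of_nat_mult by (simp add: K_def add_ac)
  ultimately have "K * real (sum (height P (h @ [M])) S) \<le> k * real (sum (height P h) (S \<union> T))"
    by simp
  \<comment> \<open>The bound for \<open>S \<union> T\<close> includes the additive term
    \<open>C * s\<close>, as Breaker is to move; spread over \<open>K\<close> boxes it becomes the
    s/K of \<open>ln_ratio_step\<close>.\<close>
  also have "\<dots> \<le> k * (C * K * ln ((K + s\<^sup>2) / K) + C * s)"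
    using assms(1)[unfolded heights_bounded_def, rule_format, of "S \<union> T"] S S' T card_ST assms(2)
    by (intro mult_left_mono) (simp_all add: s_def)
  also have "\<dots> = K * (C * k * (ln ((K + s\<^sup>2) / K) + s / K))"
    using k by (simp add: K_def field_simps)
  also have "\<dots> \<le> K * (C * k * ln ((k + (s + 1)\<^sup>2) / k))"
    using ln_ratio_step[of k s] k by (intro mult_left_mono) (auto simp: K_def algebra_simps)
  finally have "real (sum (height P (h @ [M])) S) \<le> C * k * ln ((k + (s + 1)\<^sup>2) / k)"
    using K_pos by (rule mult_left_le_imp_le)
  then show "real (sum (height P (h @ [M])) S)
      \<le> C * card S * ln ((card S + (length (h @ [M]))\<^sup>2) / card S) +
        (if mover (Suc (length (h @ [M]))) = P then 0 else C * length (h @ [M]))"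
    using assms(2) by (simp add: k_def s_def mover_Suc)
qed

text \<open>A box filled by this move was open before it, so the bound for the singleton
  \<open>{B}\<close> applies. The last move is estimated by its size alone, which avoids a factor
  \<open>C\<close> in front of the time.\<close>

lemma no_full_box_maker:
  assumes "heights_bounded P h" "mover (Suc (length h)) = P" "legal_history n (h @ [M])"
    and "C * ln (1 + (length h)\<^sup>2) + Suc (length h) < L" "B \<in> boxes"
  shows "\<not> B \<subseteq> claimed P (h @ [M])"
proof
  assume full: "B \<subseteq> claimed P (h @ [M])"
  have M: "finite M" "card M = Suc (length h)"
    using assms(3) by (auto simp: legal_history_snoc_iff legal_move_def)
  have "B \<inter> claimed (opponent P) (h @ [M]) = {}"
    using full claimed_disjoint[OF assms(3), of P] by blast
  then have "B \<in> open_boxes P h"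
    using assms by (simp add: open_boxes_def claimed_snoc)
  then have "height P h B \<le> C * ln (1 + (length h)\<^sup>2)"
    using assms(1)[unfolded heights_bounded_def, rule_format, of "{B}"] assms(2) by simp
  moreover have "B = (B \<inter> claimed P h) \<union> (B \<inter> M)"
    using full assms(2) by (auto simp: claimed_snoc)
  then have "card B \<le> height P h B + card (B \<inter> M)"
    by (metis card_Un_le height_def)
  moreover have "card (B \<inter> M) \<le> Suc (length h)"
    using M by (metis card_mono inf_le2)
  ultimately show False
    using assms(4) card_box_ge[OF assms(5)] by linarith
qed

text \<open>Both claims go through one induction: Breaker's top-hitting move exists because no box
  is full, and Maker fills no box because the heights are bounded.\<close>

lemma top_strategy_no_full_box:
  assumes "legal_history n h" "follows (opponent P) (top_strategy P) h" "length h \<le> t"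
    and "C * ln (1 + t\<^sup>2) + t < L"
  shows "heights_bounded P h \<and> (\<forall>B \<in> boxes. \<not> B \<subseteq> claimed P h)"
  using assms(1-3)
proof (induction h rule: rev_induct)
  case Nil
  \<comment> \<open>Boxes must be nonempty, or they would count as full in the empty
    history.\<close>
  have "L > 0"
    using assms(4) by (intro Nat.gr0I) (smt (verit) ln_ge_zero mult_nonneg_nonneg of_nat_0 of_nat_0_le_iff zero_le_power2)
  then have "B \<noteq> {}" if "B \<in> boxes" for B
    using card_box_ge[OF that] by auto
  then show ?case
    by (auto simp: heights_bounded_Nil)
next
  case (snoc M h)
  then have h: "legal_history n h" and IH: "heights_bounded P h" "\<And>B. B \<in> boxes \<Longrightarrow> \<not> B \<subseteq> claimed P h"
    by (auto simp: legal_history_snoc_iff follows_snoc_iff)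
  show ?case
  proof (cases "mover (Suc (length h)) = P")
    case True
    have "C * ln (1 + (length h)\<^sup>2) \<le> C * ln (1 + t\<^sup>2)"
      using snoc.prems(3) by (intro mult_left_mono ln_mono add_mono) (auto simp: power_mono add_pos_nonneg)
    then have "C * ln (1 + (length h)\<^sup>2) + Suc (length h) < L"
      using snoc.prems(3) assms(4) by simp
    then show ?thesis
      using heights_bounded_maker[OF IH(1) True snoc.prems(1)]
        no_full_box_maker[OF IH(1) True snoc.prems(1)] by blast
  next
    case False
    then have Q: "mover (Suc (length h)) = opponent P"
      by (simp add: eq_opponent_iff)
    then have "hits_top P h M"
      using exists_hits_top[OF h IH(2)] top_strategy(2)[OF h] snoc.prems(2)
      by (auto simp: follows_snoc_iff)
    then show ?thesis
      using heights_bounded_breaker[OF IH(1) Q] IH(2) False by (simp add: claimed_snoc)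
  qed
qed

end

section \<open>Segments with equally spaced starting points\<close>

text \<open>A coordinate that grows by one per step in each of the four directions, so it records
  the position along a line.\<close>

definition line_coord :: "int \<times> int \<Rightarrow> point \<Rightarrow> int" where
  "line_coord d v = (if d = (0, 1) then snd v else fst v)"

definition line_shift :: "point \<Rightarrow> int \<Rightarrow> int \<times> int \<Rightarrow> point" where
  "line_shift v i d = (fst v + i * fst d, snd v + i * snd d)"

definition grid_segments :: "nat \<Rightarrow> nat \<Rightarrow> point set set" where
  "grid_segments L \<delta> = {line_points L v d | v d. d \<in> directions \<and> int \<delta> dvd line_coord d v}"

lemma line_coord_shift: "d \<in> directions \<Longrightarrow> line_coord d (line_shift v i d) = line_coord d v + i"
  by (auto simp: directions_def line_coord_def line_shift_def)

lemma line_shift_shift: "line_shift (line_shift v i d) j d = line_shift v (i + j) d"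
  by (simp add: line_shift_def algebra_simps)

lemma line_shift_0 [simp]: "line_shift v 0 d = v"
  by (simp add: line_shift_def)

lemma line_points_eq_image: "line_points L v d = (\<lambda>i. line_shift v (int i) d) ` {..<L}"
  by (auto simp: line_points_def line_shift_def)

lemma card_line_points:
  assumes "d \<in> directions"
  shows "card (line_points L v d) = L"
proof -
  have "inj_on (\<lambda>i. line_shift v (int i) d) {..<L}"
  proof (rule inj_onI)
    fix i j :: nat
    assume "line_shift v (int i) d = line_shift v (int j) d"
    then have "line_coord d (line_shift v (int i) d) = line_coord d (line_shift v (int j) d)"
      by simp
    then show "i = j"
      by (simp add: line_coord_shift assms)
  qed
  then show ?thesis
    by (simp add: line_points_eq_image card_image)
qed

text \<open>Fewer than \<open>\<delta>\<close> steps from the start of \<open>W\<close> lead to a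
  coordinate divisible by \<open>\<delta>\<close>, and \<open>L\<close> points of \<open>W\<close>
  remain from there.\<close>

lemma winning_set_contains_grid_segment:
  assumes "W \<in> winning_sets (L + \<delta>)" "\<delta> > 0"
  obtains B where "B \<in> grid_segments L \<delta>" "B \<subseteq> W"
proof -
  obtain v d where W: "W = line_points (L + \<delta>) v d" and d: "d \<in> directions"
    using assms(1) by (auto simp: winning_sets_def)
  define j where "j = nat ((- line_coord d v) mod int \<delta>)"
  have j: "int j = (- line_coord d v) mod int \<delta>" "j < \<delta>"
    using assms(2) by (auto simp: j_def nat_less_iff)
  have "int \<delta> dvd line_coord d v + (- line_coord d v) mod int \<delta>"
    by (simp add: dvd_eq_mod_eq_0 mod_add_right_eq)
  then have "line_points L (line_shift v (int j) d) d \<in> grid_segments L \<delta>"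
    unfolding grid_segments_def using d j(1) line_coord_shift[OF d, of v "int j"]
    by (intro CollectI exI[of _ "line_shift v (int j) d"] exI[of _ d]) simp
  moreover have "line_points L (line_shift v (int j) d) d \<subseteq> W"
    unfolding W line_points_eq_image
  proof (rule image_subsetI)
    fix i assume "i \<in> {..<L}"
    then show "line_shift (line_shift v (int j) d) (int i) d \<in> (\<lambda>i. line_shift v (int i) d) ` {..<L + \<delta>}"
      using j(2) by (intro image_eqI[of _ _ "j + i"]) (auto simp: line_shift_shift)
  qed
  ultimately show thesis
    by (rule that)
qed

text \<open>In a fixed direction, the offset of a point within a segment containing it is known
  modulo \<open>\<delta>\<close> and is below \<open>L\<close>. This leaves at most \<open>m\<close>
  offsets for each of the four directions.\<close>

lemma box_family_grid_segments:
  assumes "L > 0" "\<delta> > 0" "L < m * \<delta>"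
  shows "box_family (grid_segments L \<delta>) (4 * m) L"
proof
  \<comment> \<open>The horizontal segments starting in column 0 already form an infinite
    family.\<close>
  have "inj (\<lambda>y. line_points L (0, y) (1, 0))"
  proof (rule injI)
    fix y z assume "line_points L (0, y) (1, 0) = line_points L (0, z) (1, 0)"
    moreover have "(0, y) \<in> line_points L (0, y) (1, 0)"
      using assms(1) by (force simp: line_points_def)
    ultimately show "y = z"
      by (auto simp: line_points_def)
  qed
  then have "infinite (range (\<lambda>y. line_points L (0, y) (1, 0)))"
    using finite_imageD infinite_UNIV_int by blast
  moreover have "range (\<lambda>y. line_points L (0, y) (1, 0)) \<subseteq> grid_segments L \<delta>"
  proof (rule image_subsetI)
    fix y :: int
    show "line_points L (0, y) (1, 0) \<in> grid_segments L \<delta>"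
      unfolding grid_segments_def
      by (intro CollectI exI[of _ "(0, y)"] exI[of _ "(1, 0)"])
        (simp add: directions_def line_coord_def)
  qed
  ultimately show "infinite (grid_segments L \<delta>)"
    by (rule infinite_super[rotated])
next
  fix B assume "B \<in> grid_segments L \<delta>"
  then obtain v d where "B = line_points L v d" "d \<in> directions"
    unfolding grid_segments_def by blast
  then show "L \<le> card B"
    by (simp add: card_line_points)
next
  fix x :: point
  \<comment> \<open>The segment is recovered from the quotient \<open>q\<close> of the offset of
    \<open>x\<close> by \<open>\<delta>\<close>; the remainder is fixed by \<open>x\<close> and
    \<open>d\<close>.\<close>
  define f where "f = (\<lambda>(q, d). line_points L (line_shift x (- (int q * int \<delta> + line_coord d x mod int \<delta>)) d) d)"
  have sub: "{B \<in> grid_segments L \<delta>. x \<in> B} \<subseteq> f ` ({..<m} \<times> directions)"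
  proof
    fix B assume "B \<in> {B \<in> grid_segments L \<delta>. x \<in> B}"
    then obtain v d i where d: "d \<in> directions" and B: "B = line_points L v d"
      and dvd: "int \<delta> dvd line_coord d v" and x: "x = line_shift v (int i) d" and i: "i < L"
      by (auto simp: grid_segments_def line_points_eq_image)
    have "line_coord d x mod int \<delta> = int i mod int \<delta>"
      using dvd d by (simp add: x line_coord_shift mod_add_left_eq dvd_eq_mod_eq_0 mod_add_eq[symmetric])
    then have "int (i div \<delta>) * int \<delta> + line_coord d x mod int \<delta> = int i"
      by (simp add: zdiv_int)
    then have "f (i div \<delta>, d) = line_points L (line_shift x (- int i) d) d"
      by (simp only: f_def prod.case)
    then have "B = f (i div \<delta>, d)"
      by (simp add: B x line_shift_shift)
    moreover have "i div \<delta> < m"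
      using i assms by (simp add: less_mult_imp_div_less)
    ultimately show "B \<in> f ` ({..<m} \<times> directions)"
      using d by simp
  qed
  have fin: "finite ({..<m} \<times> directions)"
    by (simp add: directions_def)
  show "finite {B \<in> grid_segments L \<delta>. x \<in> B}"
    by (rule finite_subset[OF sub finite_imageI[OF fin]])
  have "card {B \<in> grid_segments L \<delta>. x \<in> B} \<le> card ({..<m} \<times> directions)"
    by (rule surj_card_le[OF fin sub])
  then show "card {B \<in> grid_segments L \<delta>. x \<in> B} \<le> 4 * m"
    by (simp add: card_cartesian_product directions_def)
qed

section \<open>Choice of parameters and conclusion\<close>

theorem mainTheorem3:
  fixes \<epsilon> :: real
  assumes "\<epsilon> > 0"
  shows "\<exists>N :: nat. \<forall>n \<ge> N. \<forall>P :: player. \<exists>\<sigma>.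
           is_strategy n (opponent P) \<sigma> \<and>
           (\<forall>h. legal_history n h \<and> follows (opponent P) \<sigma> h \<longrightarrow>
              (\<forall>t :: nat. real t < (1 - \<epsilon>) * real n \<longrightarrow> \<not> wins_at n P h t))"
proof -
  \<comment> \<open>The loss \<open>\<epsilon> * n\<close> is split in halves:
    \<open>m \<ge> 2 / \<epsilon>\<close> keeps \<open>n div m\<close> within one half, and the
    logarithmic term takes the other. The summand 2 ensures \<open>n div m < n\<close>.\<close>
  define m where "m = nat \<lceil>2 / \<epsilon>\<rceil> + 2"
  have m: "m \<ge> 2" "real m \<ge> 2 / \<epsilon>"
    unfolding m_def by linarith+
  have "eventually (\<lambda>n::nat. real (8 * m) * ln (1 + (real n)\<^sup>2) < \<epsilon> / 2 * n) at_top"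
    using assms by real_asymp
  then obtain N0 where N0: "\<And>n::nat. n \<ge> N0 \<Longrightarrow> real (8 * m) * ln (1 + (real n)\<^sup>2) < \<epsilon> / 2 * n"
    by (auto simp: eventually_at_top_linorder)
  show ?thesis
  proof (intro exI[of _ "max N0 m"] allI impI)
    fix n :: nat and P assume n: "n \<ge> max N0 m"
    define \<delta> where "\<delta> = n div m"
    define L where "L = n - \<delta>"
    have \<delta>: "\<delta> > 0"
      using n m by (simp add: \<delta>_def div_greater_zero_iff)
    have "\<delta> < n"
      using n m by (simp add: \<delta>_def)
    then have L: "L > 0" "n = L + \<delta>"
      by (auto simp: L_def)
    \<comment> \<open>Rounding down in \<open>n div m\<close> costs at most a factor 2, so a
      direction has at most \<open>2 * m\<close> offsets and the degree is at most
      \<open>8 * m\<close>.\<close>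
    have "n < m * (\<delta> + 1)"
      using m dividend_less_times_div[of m n] by (simp add: \<delta>_def)
    also have "\<dots> \<le> 2 * m * \<delta>"
      using \<delta> by (cases \<delta>) auto
    finally have "L < 2 * m * \<delta>"
      by (simp add: L_def)
    then interpret box_family "grid_segments L \<delta>" "8 * m" L
      using box_family_grid_segments[of L \<delta> "2 * m"] L \<delta> by simp
    have "real (\<delta> * m) \<le> real n"
      unfolding \<delta>_def by (rule of_nat_mono) simp
    then have "real \<delta> \<le> n / m"
      using m by (simp add: pos_le_divide_eq)
    also have "\<dots> \<le> \<epsilon> / 2 * n"
      using m assms mult_right_mono[of 1 "\<epsilon> / 2 * m" n] by (simp add: field_simps)
    finally have L_ge: "real L \<ge> n - \<epsilon> / 2 * n"
      using L(2) by simp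
    have "\<not> wins_at n P h t"
      if h: "legal_history n h" "follows (opponent P) (top_strategy P) h" and t: "t < (1 - \<epsilon>) * n" for h t
    proof
      assume "wins_at n P h t"
      then obtain W where W: "W \<in> winning_sets n" "W \<subseteq> claimed P (take t h)"
        by (auto simp: wins_at_def completed_def)
      from W(1) obtain B where B: "B \<in> grid_segments L \<delta>" "B \<subseteq> W"
        using winning_set_contains_grid_segment \<delta> L(2) by metis
      have "0 \<le> \<epsilon> * n"
        using assms by simp
      then have "real t \<le> n"
        using t unfolding left_diff_distrib by linarith
      then have "real (8 * m) * ln (1 + (real t)\<^sup>2) \<le> real (8 * m) * ln (1 + (real n)\<^sup>2)"
        by (intro mult_left_mono ln_mono add_mono) (auto simp: power_mono add_pos_nonneg)
      also have "\<dots> < \<epsilon> / 2 * n"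
        using N0 n by simp
      \<comment> \<open>Here t < n - \<epsilon> n, the logarithmic term is below \<epsilon> n / 2,
        and \<open>L\<close> is at least n - \<epsilon> n / 2.\<close>
      finally have "real (8 * m) * ln (1 + (real t)\<^sup>2) + t < L"
        using t L_ge by (simp add: algebra_simps)
      then have "\<not> B \<subseteq> claimed P (take t h)"
        using top_strategy_no_full_box[OF legal_history_take[OF h(1)] follows_take[OF h(2)], of t t] B
        by simp
      then show False
        using B W by blast
    qed
    moreover have "is_strategy n (opponent P) (top_strategy P)"
      by (simp add: is_strategy_def top_strategy(1))
    ultimately show "\<exists>\<sigma>. is_strategy n (opponent P) \<sigma> \<and>
           (\<forall>h. legal_history n h \<and> follows (opponent P) \<sigma> h \<longrightarrow>
              (\<forall>t :: nat. real t < (1 - \<epsilon>) * real n \<longrightarrow> \<not> wins_at n P h t))"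
      by blast
  qed
qed

end
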